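(* Let $f\in\mathbb{R}^n$, $\lambda_1,\lambda_2>0$, $0<\omega_{\min}\le\omega_{\max}<1$, and let $\mathcal{W}_\Theta$ be a weight operator mapping $x\in\mathbb{R}^{3n}$ to a pair of diagonal matrices $(W_1(x),W_2(x))$ in $\mathbb{R}^{2n\times 2n}$ with $\omega_{\min}I\preceq W_i(x)\preceq\omega_{\max}I$, $i=1,2$. Let $r:=\|S\|\,\|f\|_2/\alpha$ and $\mathcal{B}=\{x\in\mathbb{R}^{3n}:\|x\|_2\le r\}$, and assume that $\mathcal{W}_\Theta$ is Lipschitz on $\mathcal{B}$ with constant $L_{\mathcal{W}}\le\kappa$. Then $\mathcal{T}_\theta$ maps the closed ball $\mathcal{B}$ into itself. Moreover: (a) (Existence) $\mathcal{T}_\theta$ has at least one fixed point in $\mathcal{B}$. (b) (Uniqueness and convergence) Let $$\mathcal{Q}:=\frac{(\lambda_1\|G\|^2+\lambda_2\|R\|^2)\,\kappa\,\|S\|\,\|f\|_2}{\alpha^2}.$$ If $\mathcal{Q}<1$, then $\mathcal{T}_\theta$ is a contraction on $\mathcal{B}$. In that case the iterates $x_k=\mathcal{T}_\theta(x_{k-1})$, $k\ge1$, started from $x_0\in\mathcal{B}$, converge linearly to the unique fixed point $x_\star\in\mathcal{B}$: $$\|x_k-x_\star\|_2\le\mathcal{Q}^k\|x_0-x_\star\|_2.$$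
   Context: Let $h,w\ge 2$ be integers and $n=hw$. For $m\ge 2$ let $B_m\in\mathbb{R}^{m\times m}$ be the matrix with $(B_m z)_i = z_{i+1}-z_i$ for $1\le i\le m-1$ and $(B_m z)_m = z_m-z_{m-1}$. Put $\nabla_x = I_h\otimes B_w$, $\nabla_y = B_h\otimes I_w$, and $\nabla = \begin{bmatrix}\nabla_x\\ \nabla_y\end{bmatrix}\in\mathbb{R}^{2n\times n}$. Define $S=[\,I_n\;\; -\nabla^\top\,]\in\mathbb{R}^{n\times 3n}$, $G=[\,\nabla\;\; 0_{2n\times 2n}\,]\in\mathbb{R}^{2n\times 3n}$, $R=[\,0_{2n\times n}\;\; I_{2n}\,]\in\mathbb{R}^{2n\times 3n}$, and $A(W_1,W_2)=S^\top S+\lambda_1G^\top W_1G+\lambda_2R^\top W_2R$, which is symmetric positive definite for admissible weights. The scalars $\lambda_1,\lambda_2$ and the data $f$ are fixed throughout the iteration. The map $\mathcal{T}_\theta:\mathbb{R}^{3n}\to\mathbb{R}^{3n}$ freezes the weights at its argument and returns the minimizer of the resulting quadratic problem: $\mathcal{T}_\theta(x)$ is the unique minimizer over $u\in\mathbb{R}^{3n}$ of $\frac12\|Su-f\|_2^2+\frac{\lambda_1}{2}(Gu)^\top W_1(x)(Gu)+\frac{\lambda_2}{2}(Ru)^\top W_2(x)(Ru)$, equivalently $\mathcal{T}_\theta(x)=A(W_1(x),W_2(x))^{-1}S^\top f$. $\alpha:=\sigma_{\min}^2(\mathcal{M})>0$, where $\sigma_{\min}$ is the smallest singular value and $\mathcal{M}=\begin{bmatrix}S\\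 \sqrt{\lambda_1\omega_{\min}}\,G\\ \sqrt{\lambda_2\omega_{\min}}\,R\end{bmatrix}$. $\|S\|,\|G\|,\|R\|$ are spectral norms; $\preceq$ is the Loewner order. Lipschitz continuity of $\mathcal{W}_\Theta$ on $\mathcal{B}$ with constant $L_{\mathcal{W}}$ means $\|\mathcal{W}_\Theta(x)-\mathcal{W}_\Theta(y)\|\le L_{\mathcal{W}}\|x-y\|_2$ for all $x,y\in\mathcal{B}$, where $\|\mathcal{W}_\Theta(x)\|:=\|\omega(x)\|_\infty$ with $\omega(x)=[\,\mathrm{diag}(W_1(x)),\mathrm{diag}(W_2(x))\,]\in\mathbb{R}^{4n}$. The number $\kappa\ge 0$ is a known upper bound for $L_{\mathcal{W}}$; in the paper $\mathcal{W}_\Theta$ is a neural network with $N$ convolutional layers spectrally normalized with factors $c_1,\dots,c_N>0$, and $\kappa=\prod_{i=1}^N c_i$. *)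

theory Defs
  imports "HOL-Analysis.Analysis"
begin

section \<open>Matrices\<close>

text \<open>Rows are indexed by \<open>'a \<times> 'c\<close> and columns by \<open>'b \<times> 'd\<close>; the lexicographic enumeration of the
  pairs is the usual flattening, with the second component varying fastest.\<close>

definition kron :: "real^'b^'a \<Rightarrow> real^'d^'c \<Rightarrow> real^('b \<times> 'd)^('a \<times> 'c)" where
  "kron P Q = (\<chi> i j. P $ fst i $ fst j * Q $ snd i $ snd j)"

definition vstack :: "real^'n^'a \<Rightarrow> real^'n^'b \<Rightarrow> real^'n^('a + 'b)" where
  "vstack P Q = (\<chi> i. case i of Inl a \<Rightarrow> P $ a | Inr b \<Rightarrow> Q $ b)"

definition hstack :: "real^'a^'m \<Rightarrow> real^'b^'m \<Rightarrow> real^('a + 'b)^'m" where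
  "hstack P Q = (\<chi> i j. case j of Inl a \<Rightarrow> P $ i $ a | Inr b \<Rightarrow> Q $ i $ b)"

definition is_diagonal :: "real^'n^'n \<Rightarrow> bool" where
  "is_diagonal M \<longleftrightarrow> (\<forall>i j. i \<noteq> j \<longrightarrow> M $ i $ j = 0)"

definition diag_entries :: "real^'n^'n \<Rightarrow> real^'n" where
  "diag_entries M = (\<chi> i. M $ i $ i)"

definition pos_semidef :: "real^'n^'n \<Rightarrow> bool" where
  "pos_semidef M \<longleftrightarrow> transpose M = M \<and> (\<forall>v. 0 \<le> v \<bullet> (M *v v))"

definition loewner_le :: "real^'n^'n \<Rightarrow> real^'n^'n \<Rightarrow> bool"  (infix \<open>\<preceq>\<close> 50) where
  "P \<preceq> Q \<longleftrightarrow> pos_semidef (Q - P)"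

definition spectral_norm :: "real^'n^'m \<Rightarrow> real" where
  "spectral_norm M = onorm (\<lambda>v. M *v v)"

text \<open>Square roots of the eigenvalues of \<open>M\<^sup>T M\<close>. For a matrix with at least as many rows as
  columns, which is the only case used below, these are exactly the singular values of \<open>M\<close>; for a
  wide matrix the value \<open>0\<close> would be added. The set is finite and non-empty, so its least element exists.\<close>

definition singular_values :: "real^'n^'m \<Rightarrow> real set" where
  "singular_values M = {s. 0 \<le> s \<and> (\<exists>v. v \<noteq> 0 \<and> (transpose M ** M) *v v = s\<^sup>2 *\<^sub>R v)}"

definition sigma_min :: "real^'n^'m \<Rightarrow> real" where
  "sigma_min M = (LEAST s. s \<in> singular_values M)"


section \<open>The difference operators\<close>

text \<open>The indices \<open>1 < \<dots> < m\<close> are the elements of a finite linearly ordered type with \<open>m\<close> elements.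
  The definition is only meaningful for \<open>m \<ge> 2\<close>.\<close>

definition diff_op :: "real^'m::{finite,linorder} \<Rightarrow> real^'m::{finite,linorder}" where
  "diff_op z = (\<chi> i. if \<exists>j. i < j then z $ Min {j. i < j} - z $ i
                     else z $ i - z $ Max {j. j < i})"

definition diff_mat :: "real^'m::{finite,linorder}^'m::{finite,linorder}" where
  "diff_mat = matrix diff_op"

lemma diff_mat_mult: "diff_mat *v (z :: real^'m::{finite,linorder}) = diff_op z"
proof -
  have "linear (diff_op :: real^'m::{finite,linorder} \<Rightarrow> _)"
    by (rule linearI) (auto simp: diff_op_def vec_eq_iff algebra_simps)
  then show ?thesis
    by (simp add: diff_mat_def matrix_works)
qed

text \<open>With \<open>h = CARD('h)\<close> and \<open>w = CARD('w)\<close>, the index types below have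
  \<open>n = h w\<close>, \<open>2n\<close>, \<open>3n\<close> and \<open>5n\<close> elements.\<close>

type_synonym ('h, 'w) ix1 = "'h \<times> 'w"
type_synonym ('h, 'w) ix2 = "('h, 'w) ix1 + ('h, 'w) ix1"
type_synonym ('h, 'w) ix3 = "('h, 'w) ix1 + ('h, 'w) ix2"
type_synonym ('h, 'w) ix5 = "('h, 'w) ix1 + (('h, 'w) ix2 + ('h, 'w) ix2)"

definition nabla_x :: "real^('h::{finite,linorder},'w::{finite,linorder}) ix1^('h,'w) ix1" where
  "nabla_x = kron (mat 1) diff_mat"

definition nabla_y :: "real^('h::{finite,linorder},'w::{finite,linorder}) ix1^('h,'w) ix1" where
  "nabla_y = kron diff_mat (mat 1)"

definition nabla :: "real^('h::{finite,linorder},'w::{finite,linorder}) ix1^('h,'w) ix2" where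
  "nabla = vstack nabla_x nabla_y"

definition S_mat :: "real^('h::{finite,linorder},'w::{finite,linorder}) ix3^('h,'w) ix1" where
  "S_mat = hstack (mat 1) (- transpose nabla)"

definition G_mat :: "real^('h::{finite,linorder},'w::{finite,linorder}) ix3^('h,'w) ix2" where
  "G_mat = hstack nabla 0"

definition R_mat :: "real^('h::{finite,linorder},'w::{finite,linorder}) ix3^('h,'w) ix2" where
  "R_mat = hstack 0 (mat 1)"

definition M_mat ::
  "real \<Rightarrow> real \<Rightarrow> real \<Rightarrow> real^('h::{finite,linorder},'w::{finite,linorder}) ix3^('h,'w) ix5" where
  "M_mat lam1 lam2 \<omega>\<^sub>m\<^sub>i\<^sub>n =
     vstack S_mat (vstack (sqrt (lam1 * \<omega>\<^sub>m\<^sub>i\<^sub>n) *\<^sub>R G_mat) (sqrt (lam2 * \<omega>\<^sub>m\<^sub>i\<^sub>n) *\<^sub>R R_mat))"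


section \<open>Weights and the frozen-weight iteration map\<close>

type_synonym ('h, 'w) weights =
  "(real^('h, 'w) ix2^('h, 'w) ix2) \<times> (real^('h, 'w) ix2^('h, 'w) ix2)"

definition admissible_weights ::
  "real \<Rightarrow> real \<Rightarrow> ('h::finite, 'w::finite) weights \<Rightarrow> bool" where
  "admissible_weights \<omega>\<^sub>m\<^sub>i\<^sub>n \<omega>\<^sub>m\<^sub>a\<^sub>x V \<longleftrightarrow>
     (\<forall>U \<in> {fst V, snd V}. is_diagonal U \<and> \<omega>\<^sub>m\<^sub>i\<^sub>n *\<^sub>R mat 1 \<preceq> U \<and> U \<preceq> \<omega>\<^sub>m\<^sub>a\<^sub>x *\<^sub>R mat 1)"

definition weight_vec ::
  "('h::finite, 'w::finite) weights \<Rightarrow> real^(('h, 'w) ix2 + ('h, 'w) ix2)" where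
  "weight_vec V = (\<chi> i. case i of Inl a \<Rightarrow> diag_entries (fst V) $ a | Inr b \<Rightarrow> diag_entries (snd V) $ b)"

text \<open>The sup norm of the diagonals; it is not the norm of the product type.\<close>

definition weight_norm :: "('h::finite, 'w::finite) weights \<Rightarrow> real" where
  "weight_norm V = infnorm (weight_vec V)"

definition energy ::
  "real \<Rightarrow> real \<Rightarrow> real^('h::{finite,linorder},'w::{finite,linorder}) ix1 \<Rightarrow> ('h, 'w) weights
    \<Rightarrow> real^('h,'w) ix3 \<Rightarrow> real" where
  "energy lam1 lam2 f V u =
     1/2 * (norm (S_mat *v u - f))\<^sup>2
     + lam1/2 * ((G_mat *v u) \<bullet> (fst V *v (G_mat *v u)))
     + lam2/2 * ((R_mat *v u) \<bullet> (snd V *v (R_mat *v u)))"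

definition T_map ::
  "real \<Rightarrow> real \<Rightarrow> real^('h::{finite,linorder},'w::{finite,linorder}) ix1
    \<Rightarrow> (real^('h,'w) ix3 \<Rightarrow> ('h, 'w) weights) \<Rightarrow> real^('h,'w) ix3 \<Rightarrow> real^('h,'w) ix3" where
  "T_map lam1 lam2 f \<W> x = (THE u. is_arg_min (energy lam1 lam2 f (\<W> x)) (\<lambda>_. True) u)"

definition contraction_on :: "'a::metric_space set \<Rightarrow> ('a \<Rightarrow> 'a) \<Rightarrow> bool" where
  "contraction_on X T \<longleftrightarrow> (\<exists>c<1. c-lipschitz_on X T)"

end

theory Submission
  imports Defs
begin

text \<open>
  Write \<open>b\<^sub>V\<close> for the bilinear form of \<open>A(W\<^sub>1, W\<^sub>2)\<close>. The bound \<open>W\<^sub>i \<ge> \<omega>\<^sub>m\<^sub>i\<^sub>n I\<close> gives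
  \<open>b\<^sub>V u u \<ge> \<parallel>M u\<parallel>\<^sup>2 \<ge> \<alpha> \<parallel>u\<parallel>\<^sup>2\<close>, and \<open>T x\<close> is the unique \<open>u\<close> with \<open>b\<^sub>V u v = S v \<bullet> f\<close> for all \<open>v\<close>.
  Testing with \<open>v = u\<close> gives \<open>\<parallel>T x\<parallel> \<le> r\<close>. Subtracting the equations of \<open>T x\<close> and \<open>T y\<close> and testing with
  \<open>T x - T y\<close> gives \<open>\<alpha> \<parallel>T x - T y\<parallel> \<le> (\<lambda>\<^sub>1 \<parallel>G\<parallel>\<^sup>2 + \<lambda>\<^sub>2 \<parallel>R\<parallel>\<^sup>2) \<kappa> \<parallel>x - y\<parallel> r\<close>, so \<open>T\<close> is
  \<open>Q\<close>-Lipschitz on the ball. Brouwer's theorem and iteration of this estimate finish the proof.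
\<close>

section \<open>Coercive quadratic problems\<close>

text \<open>A finite-dimensional Lax-Milgram argument: mapping \<open>u\<close> to the Riesz vector
  \<open>F u\<close> of \<open>b u\<close> is linear, coercivity forces a trivial kernel, and an
  injective endomorphism is onto.\<close>

lemma coercive_representation:
  fixes b :: "'a::euclidean_space \<Rightarrow> 'a \<Rightarrow> real"
  assumes b: "bilinear b" and l: "linear l"
    and coercive: "\<And>u. a * (norm u)\<^sup>2 \<le> b u u" and "0 < a"
  obtains u where "\<And>v. b u v = l v"
proof -
  have lin2: "linear (b u)" and lin1: "linear (\<lambda>u. b u v)" for u v
    using b by (auto simp: bilinear_def)
  define F where "F u = (\<Sum>i\<in>Basis. b u i *\<^sub>R i)" for u
  have expand: "h v = (\<Sum>i\<in>Basis. h i *\<^sub>R i) \<bullet> v" if "linear h" for h :: "'a \<Rightarrow> real" and v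
  proof -
    have "h v = h (\<Sum>i\<in>Basis. (v \<bullet> i) *\<^sub>R i)"
      by (simp add: euclidean_representation)
    also have "\<dots> = (\<Sum>i\<in>Basis. (v \<bullet> i) * h i)"
      by (simp add: linear_sum[OF that] linear_scale[OF that])
    also have "\<dots> = (\<Sum>i\<in>Basis. h i *\<^sub>R i) \<bullet> v"
      by (simp add: inner_sum_right inner_commute[of _ v] mult.commute)
    finally show ?thesis .
  qed
  have F: "F u \<bullet> v = b u v" for u v
    using expand[OF lin2[of u], of v] by (simp add: F_def)
  have "linear F"
    by (intro linearI) (simp_all add: F_def linear_add[OF lin1] linear_scale[OF lin1]
        scaleR_left_distrib sum.distrib scaleR_sum_right)
  moreover have "inj F"
    unfolding linear_injective_0[OF \<open>linear F\<close>]
  proof (intro allI impI)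
    fix u assume "F u = 0"
    then have "a * (norm u)\<^sup>2 \<le> 0"
      using coercive[of u] F[of u u] by simp
    with \<open>0 < a\<close> show "u = 0"
      by (simp add: mult_le_0_iff)
  qed
  ultimately have "surj F"
    by (rule linear_inj_imp_surj)
  then obtain u where "F u = (\<Sum>i\<in>Basis. l i *\<^sub>R i)"
    by (metis surjD)
  then have "b u v = l v" for v
    using F[of u v] expand[OF l, of v] by simp
  then show ?thesis by (rule that)
qed

text \<open>Completing the square at the solution \<open>u\<close> of the weak equation leaves only
  \<open>b (v - u) (v - u) / 2\<close>, which is positive for \<open>v \<noteq> u\<close>. The
  description by \<open>THE\<close> therefore denotes \<open>u\<close>, and later proofs work with
  the equation alone.\<close>

lemma coercive_quadratic_minimizer:
  fixes b :: "'a::euclidean_space \<Rightarrow> 'a \<Rightarrow> real"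
  assumes b: "bilinear b" and sym: "\<And>u v. b u v = b v u" and l: "linear l"
    and coercive: "\<And>u. a * (norm u)\<^sup>2 \<le> b u u" and "0 < a"
    and E: "\<And>u. E u = b u u / 2 - l u + c"
  shows "b (THE u. is_arg_min E (\<lambda>_. True) u) v = l v"
proof -
  obtain u where u: "\<And>v. b u v = l v"
    using coercive_representation[OF b l coercive \<open>0 < a\<close>] by blast
  have shift: "E v = E u + b (v - u) (v - u) / 2" for v
  proof -
    have "b (v - u) (v - u) = b v v - 2 * b u v + b u u"
      using sym[of v u] by (simp add: bilinear_lsub[OF b] bilinear_rsub[OF b])
    then show ?thesis
      by (simp add: E u field_simps)
  qed
  have gap: "E u + a / 2 * (norm (v - u))\<^sup>2 \<le> E v" for v
    using coercive[of "v - u"] shift[of v] by simp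
  have le: "E u \<le> E v" for v
  proof -
    have "0 \<le> a / 2 * (norm (v - u))\<^sup>2"
      using \<open>0 < a\<close> by simp
    with gap[of v] show ?thesis by linarith
  qed
  have less: "E u < E v" if "v \<noteq> u" for v
  proof -
    have "0 < a / 2 * (norm (v - u))\<^sup>2"
      using that \<open>0 < a\<close> by simp
    with gap[of v] show ?thesis by linarith
  qed
  have "(THE u. is_arg_min E (\<lambda>_. True) u) = u"
  proof (rule the_equality)
    show "is_arg_min E (\<lambda>_. True) u"
      unfolding is_arg_min_def using le by (simp add: not_less)
    show "v = u" if "is_arg_min E (\<lambda>_. True) v" for v
      using that less[of v] unfolding is_arg_min_def by blast
  qed
  with u show ?thesis by simp
qed


section \<open>The smallest singular value\<close>

lemma inner_transpose_mult:
  fixes M :: "real^'n^'m"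
  shows "v \<bullet> ((transpose M ** M) *v w) = (M *v v) \<bullet> (M *v w)"
  by (simp add: matrix_vector_mul_assoc[symmetric] inner_commute[of v] dot_lmul_matrix
      inner_commute[of "M *v w"])

lemma norm_diff_scaleR_squared:
  fixes x y :: "'a::real_inner"
  shows "(norm (x - t *\<^sub>R y))\<^sup>2 = (norm x)\<^sup>2 - 2 * t * (y \<bullet> x) + t\<^sup>2 * (norm y)\<^sup>2"
  unfolding power2_norm_eq_inner
  by (simp add: inner_diff_left inner_diff_right inner_commute power2_eq_square[of t] algebra_simps)

text \<open>A minimizer of \<open>\<parallel>M v\<parallel>\<close> on the unit sphere is an eigenvector of \<open>M\<^sup>T M\<close>: perturbing it in the
  direction of the residual \<open>w\<close> would otherwise decrease the Rayleigh quotient.\<close>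

lemma minimal_singular_vector:
  fixes M :: "real^'n^'m"
  obtains v where "norm v = 1" "norm (M *v v) \<in> singular_values M"
    "\<And>u. norm (M *v v) * norm u \<le> norm (M *v u)"
proof -
  have "compact (sphere (0::real^'n) 1)" "sphere (0::real^'n) 1 \<noteq> {}"
    by simp_all
  moreover have "continuous_on (sphere (0::real^'n) 1) (\<lambda>v. norm (M *v v))"
    by (intro continuous_on_norm linear_continuous_on matrix_vector_mul_bounded_linear)
  ultimately obtain v where v: "norm v = 1"
    and min: "\<And>u. norm u = 1 \<Longrightarrow> norm (M *v v) \<le> norm (M *v u)"
    using continuous_attains_inf[of "sphere (0::real^'n) 1" "\<lambda>v. norm (M *v v)"] by auto
  define m where "m = norm (M *v v)"
  have bound: "m * norm u \<le> norm (M *v u)" for u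
  proof (cases "u = 0")
    case False
    then have "m \<le> norm (M *v (inverse (norm u) *\<^sub>R u))"
      unfolding m_def by (intro min) simp
    with False show ?thesis
      by (simp add: matrix_vector_mult_scaleR field_simps)
  qed simp
  define w where "w = (transpose M ** M) *v v - m\<^sup>2 *\<^sub>R v"
  \<comment> \<open>The coefficient of \<open>t\<^sup>2\<close> in the perturbation
    \<open>v - t *\<^sub>R w\<close>; it is nonnegative by the minimality of
    \<open>m\<close>.\<close>
  define c where "c = (norm (M *v w))\<^sup>2 - m\<^sup>2 * (norm w)\<^sup>2"
  have c: "0 \<le> c"
    using power_mono[OF bound[of w], of 2] by (simp add: c_def m_def power_mult_distrib)
  have residual: "(norm w)\<^sup>2 = (M *v w) \<bullet> (M *v v) - m\<^sup>2 * (w \<bullet> v)"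
  proof -
    have "w \<bullet> w = w \<bullet> ((transpose M ** M) *v v - m\<^sup>2 *\<^sub>R v)"
      by (simp only: w_def)
    then show ?thesis
      by (simp only: inner_diff_right inner_scaleR_right inner_transpose_mult power2_norm_eq_inner)
  qed
  \<comment> \<open>The constant term drops out because \<open>norm (M *v v) = m\<close> and
    \<open>norm v = 1\<close>; \<open>residual\<close> identifies the linear one.\<close>
  have ineq: "0 \<le> - 2 * t * (norm w)\<^sup>2 + t\<^sup>2 * c" for t
  proof -
    have "(m * norm (v - t *\<^sub>R w))\<^sup>2 \<le> (norm (M *v (v - t *\<^sub>R w)))\<^sup>2"
      by (rule power_mono[OF bound]) (simp add: m_def)
    moreover have "- 2 * t * (norm w)\<^sup>2 + t\<^sup>2 * c
        = (norm (M *v (v - t *\<^sub>R w)))\<^sup>2 - m\<^sup>2 * (norm (v - t *\<^sub>R w))\<^sup>2"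
      unfolding c_def matrix_vector_mult_diff_distrib matrix_vector_mult_scaleR
        norm_diff_scaleR_squared m_def[symmetric] v residual
      by (simp add: algebra_simps)
    ultimately show ?thesis
      by (simp add: power_mult_distrib)
  qed
  have "w = 0"
  proof (rule ccontr)
    assume "w \<noteq> 0"
    then have p: "0 < (norm w)\<^sup>2" by simp
    \<comment> \<open>Small enough for the linear term to dominate; \<open>c + 1\<close> in place of
      \<open>c\<close> keeps the quotient meaningful when \<open>c = 0\<close>.\<close>
    define t where "t = (norm w)\<^sup>2 / (c + 1)"
    have t: "0 < t" "t * c < 2 * (norm w)\<^sup>2"
      using p c by (auto simp: t_def field_simps add_nonneg_pos)
    have "t * (2 * (norm w)\<^sup>2) \<le> t * (t * c)"
      using ineq[of t] by (simp add: power2_eq_square algebra_simps)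
    with t show False by simp
  qed
  moreover have "v \<noteq> 0" "0 \<le> m"
    using v by (auto simp: m_def)
  ultimately have "m \<in> singular_values M"
    unfolding singular_values_def w_def by auto
  with v bound show ?thesis
    using that[of v] by (simp add: m_def)
qed

lemma singular_value_attained:
  fixes M :: "real^'n^'m"
  assumes "s \<in> singular_values M"
  obtains v where "v \<noteq> 0" "norm (M *v v) = s * norm v"
proof -
  obtain v where v: "0 \<le> s" "v \<noteq> 0" "(transpose M ** M) *v v = s\<^sup>2 *\<^sub>R v"
    using assms by (auto simp: singular_values_def)
  then have "(norm (M *v v))\<^sup>2 = (s * norm v)\<^sup>2"
    using inner_transpose_mult[of v M v] by (simp add: power2_norm_eq_inner power_mult_distrib)
  with v have "norm (M *v v) = s * norm v"
    by (simp add: power2_eq_iff_nonneg)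
  with v that show ?thesis by blast
qed

text \<open>The minimum of the norm of \<open>M *v v\<close> over the unit sphere is itself a
  singular value, and every singular value is attained at some nonzero vector, so none lies below
  it. Hence \<open>LEAST\<close> is well defined here although the reals are not
  well-ordered.\<close>

lemma sigma_min_attained:
  fixes M :: "real^'n^'m"
  obtains v where "norm v = 1" "sigma_min M = norm (M *v v)"
    "\<And>u. sigma_min M * norm u \<le> norm (M *v u)"
proof -
  obtain v where v: "norm v = 1" "norm (M *v v) \<in> singular_values M"
    and bound: "\<And>u. norm (M *v v) * norm u \<le> norm (M *v u)"
    using minimal_singular_vector by blast
  have "sigma_min M = norm (M *v v)"
    unfolding sigma_min_def
  proof (rule Least_equality[where P = "\<lambda>s. s \<in> singular_values M", OF v(2)])
    fix s assume "s \<in> singular_values M"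
    then obtain u where "u \<noteq> 0" "norm (M *v u) = s * norm u"
      by (rule singular_value_attained)
    with bound[of u] show "norm (M *v v) \<le> s" by simp
  qed
  with v bound that[of v] show ?thesis by simp
qed

lemma sigma_min_le:
  fixes M :: "real^'n^'m"
  shows "(sigma_min M)\<^sup>2 * (norm u)\<^sup>2 \<le> (norm (M *v u))\<^sup>2"
proof -
  obtain v where "sigma_min M = norm (M *v v)" "sigma_min M * norm u \<le> norm (M *v u)"
    using sigma_min_attained by blast
  then show ?thesis
    using power_mono[of "sigma_min M * norm u" "norm (M *v u)" 2] by (simp add: power_mult_distrib)
qed

lemma sigma_min_pos:
  fixes M :: "real^'n^'m"
  assumes "\<And>v. M *v v = 0 \<Longrightarrow> v = 0"
  shows "0 < sigma_min M"
proof -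
  obtain v where "norm v = 1" "sigma_min M = norm (M *v v)"
    using sigma_min_attained by blast
  moreover from this have "M *v v \<noteq> 0"
    using assms[of v] by fastforce
  ultimately show ?thesis by simp
qed

section \<open>Operator norm estimates\<close>

lemma spectral_norm_bound: "norm (M *v v) \<le> spectral_norm M * norm v"
  unfolding spectral_norm_def by (rule onorm[OF matrix_vector_mul_bounded_linear])

lemma spectral_norm_nonneg: "0 \<le> spectral_norm M"
  unfolding spectral_norm_def by (rule onorm_pos_le[OF matrix_vector_mul_bounded_linear])


section \<open>Diagonal weights and block matrices\<close>

lemma is_diagonal_mult_nth:
  assumes "is_diagonal U"
  shows "(U *v v) $ i = U $ i $ i * v $ i"
proof -
  have "(U *v v) $ i = (\<Sum>j\<in>UNIV. U $ i $ j * v $ j)"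
    by (simp add: matrix_vector_mult_def)
  also have "\<dots> = (\<Sum>j\<in>UNIV. if j = i then U $ i $ i * v $ i else 0)"
    by (rule sum.cong) (use assms in \<open>auto simp: is_diagonal_def\<close>)
  finally show ?thesis by simp
qed

lemma is_diagonal_inner_commute:
  assumes "is_diagonal U"
  shows "v \<bullet> (U *v w) = w \<bullet> (U *v v)"
  using assms by (simp add: inner_vec_def is_diagonal_mult_nth ac_simps)

text \<open>Lets a sup-norm bound on diagonal entries control the bilinear form: entrywise,
  \<open>U *v w\<close> is dominated by \<open>c *\<^sub>R w\<close>, and Cauchy-Schwarz does the
  rest.\<close>

lemma is_diagonal_inner_le:
  assumes U: "is_diagonal U" and c: "\<And>i. \<bar>U $ i $ i\<bar> \<le> c"
  shows "\<bar>v \<bullet> (U *v w)\<bar> \<le> c * (norm v * norm w)"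
proof -
  \<comment> \<open>Any index serves; \<open>undefined\<close> witnesses that the index type is
    inhabited.\<close>
  have "0 \<le> c"
    using c[of undefined] by linarith
  have "norm (U *v w) \<le> norm (c *\<^sub>R w)"
    by (rule norm_le_componentwise_cart)
      (use U c \<open>0 \<le> c\<close> in \<open>simp add: is_diagonal_mult_nth abs_mult mult_right_mono\<close>)
  then have "norm v * norm (U *v w) \<le> norm v * (c * norm w)"
    using \<open>0 \<le> c\<close> by (intro mult_left_mono) auto
  with Cauchy_Schwarz_ineq2[of v "U *v w"] show ?thesis
    by (simp add: ac_simps)
qed

lemma scaled_identity_loewner_leD:
  assumes "c *\<^sub>R mat 1 \<preceq> U"
  shows "c * (norm v)\<^sup>2 \<le> v \<bullet> (U *v v)"
proof -
  have "0 \<le> v \<bullet> ((U - c *\<^sub>R mat 1) *v v)"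
    using assms by (simp add: loewner_le_def pos_semidef_def)
  then show ?thesis
    by (simp add: matrix_vector_mult_diff_rdistrib scaleR_matrix_vector_assoc[symmetric]
        inner_diff_right power2_norm_eq_inner)
qed

lemma weight_entries_le:
  "\<bar>fst V $ i $ i\<bar> \<le> weight_norm V" "\<bar>snd V $ i $ i\<bar> \<le> weight_norm V"
  using component_le_infnorm_cart[of "weight_vec V" "Inl i"]
    component_le_infnorm_cart[of "weight_vec V" "Inr i"]
  by (simp_all add: weight_norm_def weight_vec_def diag_entries_def)

lemma weight_norm_nonneg: "0 \<le> weight_norm V"
  by (simp add: weight_norm_def infnorm_pos_le)

section \<open>Block matrices and the kernel of \<open>M_mat\<close>\<close>

lemma sum_UNIV_Plus:
  fixes h :: "'a::finite + 'b::finite \<Rightarrow> 'c::comm_monoid_add"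
  shows "(\<Sum>i\<in>UNIV. h i) = (\<Sum>i\<in>UNIV. h (Inl i)) + (\<Sum>i\<in>UNIV. h (Inr i))"
  using sum.Plus[of UNIV UNIV h] by simp

lemma norm_vstack_mult:
  "(norm (vstack P Q *v v))\<^sup>2 = (norm (P *v v))\<^sup>2 + (norm (Q *v v))\<^sup>2"
  by (simp add: power2_norm_eq_inner inner_vec_def sum_UNIV_Plus vstack_def matrix_vector_mult_def)

lemma hstack_mult:
  "hstack P Q *v v = P *v (\<chi> i. v $ Inl i) + Q *v (\<chi> i. v $ Inr i)"
  by (simp add: vec_eq_iff hstack_def matrix_vector_mult_def sum_UNIV_Plus)

lemma norm_M_mat_mult:
  assumes "0 \<le> lam1 * \<omega>" "0 \<le> lam2 * \<omega>"
  shows "(norm (M_mat lam1 lam2 \<omega> *v v))\<^sup>2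
    = (norm (S_mat *v v))\<^sup>2 + lam1 * \<omega> * (norm (G_mat *v v))\<^sup>2 + lam2 * \<omega> * (norm (R_mat *v v))\<^sup>2"
  using assms
  by (simp add: M_mat_def norm_vstack_mult scaleR_matrix_vector_assoc[symmetric] power_mult_distrib)

text \<open>The squared norm splits into nonnegative terms, so each vanishes. \<open>R_mat\<close>
  reads off the second block of \<open>v\<close>, and once that is zero, \<open>S_mat\<close> reads
  off the first.\<close>

lemma M_mat_mult_eq_0D:
  fixes v :: "real^('h::{finite,linorder},'w::{finite,linorder}) ix3"
  assumes pos: "0 < lam1 * \<omega>" "0 < lam2 * \<omega>" and "M_mat lam1 lam2 \<omega> *v v = 0"
  shows "v = 0"
proof -
  have sum0: "(norm (S_mat *v v))\<^sup>2 + lam1 * \<omega> * (norm (G_mat *v v))\<^sup>2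
      + lam2 * \<omega> * (norm (R_mat *v v))\<^sup>2 = 0"
    using norm_M_mat_mult[of lam1 \<omega> lam2 v] assms by simp
  have nonneg: "0 \<le> (norm (S_mat *v v))\<^sup>2" "0 \<le> lam1 * \<omega> * (norm (G_mat *v v))\<^sup>2"
    "0 \<le> lam2 * \<omega> * (norm (R_mat *v v))\<^sup>2"
    using pos by auto
  have "(norm (S_mat *v v))\<^sup>2 = 0" "lam2 * \<omega> * (norm (R_mat *v v))\<^sup>2 = 0"
    using sum0 nonneg by linarith+
  then have S: "S_mat *v v = 0" and R: "R_mat *v v = 0"
    using pos by auto
  have Inr: "(\<chi> i. v $ Inr i) = 0"
    using R by (simp add: R_mat_def hstack_mult)
  with S have Inl: "(\<chi> i. v $ Inl i) = 0"
    by (simp add: S_mat_def hstack_mult)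
  \<comment> \<open>In each case of \<open>i\<close> only the matching projection matters; the other
    instance is harmless.\<close>
  have "v $ i = 0" for i
    using arg_cong[OF Inl, of "\<lambda>x. x $ projl i"] arg_cong[OF Inr, of "\<lambda>x. x $ projr i"]
    by (cases i) simp_all
  then show "v = 0"
    by (simp add: vec_eq_iff)
qed


section \<open>The frozen-weight iteration map\<close>

text \<open>This is the form \<open>b\<^sub>V\<close> of the matrix
  \<open>A(W\<^sub>1, W\<^sub>2)\<close>; using it avoids forming the matrix or its inverse.\<close>

definition weighted_form ::
  "real \<Rightarrow> real \<Rightarrow> ('h::{finite,linorder}, 'w::{finite,linorder}) weights
    \<Rightarrow> real^('h,'w) ix3 \<Rightarrow> real^('h,'w) ix3 \<Rightarrow> real" where
  "weighted_form lam1 lam2 V u v =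
     (S_mat *v u) \<bullet> (S_mat *v v)
     + lam1 * ((G_mat *v u) \<bullet> (fst V *v (G_mat *v v)))
     + lam2 * ((R_mat *v u) \<bullet> (snd V *v (R_mat *v v)))"

lemma bilinear_weighted_form: "bilinear (weighted_form lam1 lam2 V)"
  unfolding bilinear_def weighted_form_def
  by (auto intro!: linearI simp: matrix_vector_right_distrib matrix_vector_mult_scaleR
      inner_add algebra_simps)

lemma weighted_form_commute:
  assumes "admissible_weights a b V"
  shows "weighted_form lam1 lam2 V u v = weighted_form lam1 lam2 V v u"
  using assms unfolding weighted_form_def admissible_weights_def
  by (simp add: inner_commute[of "S_mat *v u"]
      is_diagonal_inner_commute[of "fst V" "G_mat *v u"]
      is_diagonal_inner_commute[of "snd V" "R_mat *v u"])

text \<open>Replacing both weights by their lower bound \<open>a\<close> turns the form into exactly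
  the squared norm of \<open>M_mat lam1 lam2 a *v u\<close>.\<close>

lemma weighted_form_coercive:
  fixes u :: "real^('h::{finite,linorder},'w::{finite,linorder}) ix3"
  assumes V: "admissible_weights a b V" and "0 < lam1" "0 < lam2" "0 < a"
  shows "(sigma_min (M_mat lam1 lam2 a :: real^('h,'w) ix3^('h,'w) ix5))\<^sup>2 * (norm u)\<^sup>2
    \<le> weighted_form lam1 lam2 V u u"
proof -
  have "a * (norm (G_mat *v u))\<^sup>2 \<le> (G_mat *v u) \<bullet> (fst V *v (G_mat *v u))"
    "a * (norm (R_mat *v u))\<^sup>2 \<le> (R_mat *v u) \<bullet> (snd V *v (R_mat *v u))"
    using V by (auto simp: admissible_weights_def intro: scaled_identity_loewner_leD)
  then have "lam1 * a * (norm (G_mat *v u))\<^sup>2 \<le> lam1 * ((G_mat *v u) \<bullet> (fst V *v (G_mat *v u)))"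
    "lam2 * a * (norm (R_mat *v u))\<^sup>2 \<le> lam2 * ((R_mat *v u) \<bullet> (snd V *v (R_mat *v u)))"
    using assms by (simp_all add: mult.assoc)
  moreover have "(norm (M_mat lam1 lam2 a *v u))\<^sup>2 = (S_mat *v u) \<bullet> (S_mat *v u)
      + lam1 * a * (norm (G_mat *v u))\<^sup>2 + lam2 * a * (norm (R_mat *v u))\<^sup>2"
    using norm_M_mat_mult[of lam1 a lam2 u] assms(2-)
    by (simp add: power2_norm_eq_inner[of "S_mat *v u"])
  ultimately have "(norm (M_mat lam1 lam2 a *v u))\<^sup>2 \<le> weighted_form lam1 lam2 V u u"
    unfolding weighted_form_def by linarith
  with sigma_min_le[of "M_mat lam1 lam2 a :: real^('h,'w) ix3^('h,'w) ix5" u]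
  show ?thesis by linarith
qed

text \<open>Positivity of \<alpha> is derived from the trivial kernel, not assumed.\<close>

lemma sigma_min_M_mat_pos:
  assumes "0 < lam1" "0 < lam2" "0 < a"
  shows "0 < sigma_min (M_mat lam1 lam2 a
    :: real^('h::{finite,linorder},'w::{finite,linorder}) ix3^('h,'w) ix5)"
  using assms by (intro sigma_min_pos M_mat_mult_eq_0D) auto

lemma T_map_equation:
  fixes f :: "real^('h::{finite,linorder},'w::{finite,linorder}) ix1"
  assumes V: "admissible_weights a b (\<W> x)" and "0 < lam1" "0 < lam2" "0 < a"
  shows "weighted_form lam1 lam2 (\<W> x) (T_map lam1 lam2 f \<W> x) v = (S_mat *v v) \<bullet> f"
  unfolding T_map_def
proof (rule coercive_quadratic_minimizer[OF bilinear_weighted_form weighted_form_commute[OF V]])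
  show "0 < (sigma_min (M_mat lam1 lam2 a :: real^('h,'w) ix3^('h,'w) ix5))\<^sup>2"
    using sigma_min_M_mat_pos[OF assms(2-), where 'h = 'h and 'w = 'w] by simp
  show "linear (\<lambda>v. (S_mat *v v) \<bullet> f)"
    by (intro linearI) (simp_all add: matrix_vector_right_distrib matrix_vector_mult_scaleR inner_add)
  show "energy lam1 lam2 f (\<W> x) u
      = weighted_form lam1 lam2 (\<W> x) u u / 2 - (S_mat *v u) \<bullet> f + (norm f)\<^sup>2 / 2" for u
    unfolding energy_def weighted_form_def
    by (simp add: power2_norm_eq_inner inner_diff inner_commute field_simps)
qed (rule weighted_form_coercive[OF assms])

text \<open>The bound does not depend on the size of \<open>x\<close>, so it puts the whole image of
  the map into the ball.\<close>

lemma T_map_bound: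
  fixes f :: "real^('h::{finite,linorder},'w::{finite,linorder}) ix1"
  assumes V: "admissible_weights a b (\<W> x)" and pos: "0 < lam1" "0 < lam2" "0 < a"
  shows "norm (T_map lam1 lam2 f \<W> x)
    \<le> spectral_norm (S_mat :: real^('h,'w) ix3^('h,'w) ix1) * norm f
      / (sigma_min (M_mat lam1 lam2 a :: real^('h,'w) ix3^('h,'w) ix5))\<^sup>2"
    (is "norm ?u \<le> ?s * norm f / ?\<alpha>")
proof -
  have "?\<alpha> * (norm ?u)\<^sup>2 \<le> (S_mat *v ?u) \<bullet> f"
    using weighted_form_coercive[OF V pos, of ?u] T_map_equation[where \<W> = \<W>, OF V pos] by simp
  also have "\<dots> \<le> norm (S_mat *v ?u) * norm f"
    by (rule norm_cauchy_schwarz)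
  also have "\<dots> \<le> ?s * norm ?u * norm f"
    by (intro mult_right_mono spectral_norm_bound) simp
  finally have "norm ?u * (?\<alpha> * norm ?u) \<le> norm ?u * (?s * norm f)"
    by (simp add: power2_eq_square ac_simps)
  then have "?\<alpha> * norm ?u \<le> ?s * norm f"
    by (cases "?u = 0") (simp_all add: spectral_norm_nonneg)
  with sigma_min_M_mat_pos[OF pos, where 'h = 'h and 'w = 'w] show ?thesis
    by (simp add: pos_le_divide_eq mult.commute)
qed

text \<open>The \<open>S_mat\<close> terms cancel. Each remaining block contains a difference of
  diagonal weights, bounded by \<open>weight_norm (V - U)\<close>, between two factors that each
  cost one operator norm.\<close>

lemma weighted_form_diff_le:
  fixes u v :: "real^('h::{finite,linorder},'w::{finite,linorder}) ix3"
  assumes V: "admissible_weights a b V" and U: "admissible_weights a b U"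
    and pos: "0 \<le> lam1" "0 \<le> lam2"
  shows "weighted_form lam1 lam2 V u v - weighted_form lam1 lam2 U u v
    \<le> (lam1 * (spectral_norm (G_mat :: real^('h,'w) ix3^('h,'w) ix2))\<^sup>2
        + lam2 * (spectral_norm (R_mat :: real^('h,'w) ix3^('h,'w) ix2))\<^sup>2)
      * weight_norm (V - U) * norm u * norm v"
proof -
  let ?d = "weight_norm (V - U)"
  have d: "0 \<le> ?d"
    by (rule weight_norm_nonneg)
  have diag: "is_diagonal (fst V - fst U)" "is_diagonal (snd V - snd U)"
    using V U by (auto simp: admissible_weights_def is_diagonal_def)
  have block: "(A *v u) \<bullet> ((X - Y) *v (A *v v)) \<le> (spectral_norm A)\<^sup>2 * ?d * norm u * norm v"
    if "is_diagonal (X - Y)" "\<And>i. \<bar>(X - Y) $ i $ i\<bar> \<le> ?d"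
    for A :: "real^('h,'w) ix3^('h,'w) ix2" and X Y
  proof -
    have "(A *v u) \<bullet> ((X - Y) *v (A *v v)) \<le> ?d * (norm (A *v u) * norm (A *v v))"
      using is_diagonal_inner_le[OF that, of "A *v u" "A *v v"] by linarith
    also have "\<dots> \<le> ?d * ((spectral_norm A * norm u) * (spectral_norm A * norm v))"
      by (intro mult_left_mono mult_mono spectral_norm_bound d)
        (simp_all add: spectral_norm_nonneg)
    finally show ?thesis by (simp add: power2_eq_square ac_simps)
  qed
  have "lam1 * ((G_mat *v u) \<bullet> ((fst V - fst U) *v (G_mat *v v)))
      \<le> lam1 * ((spectral_norm (G_mat :: real^('h,'w) ix3^('h,'w) ix2))\<^sup>2 * ?d * norm u * norm v)"
    using weight_entries_le(1)[of "V - U"] by (intro mult_left_mono block diag pos) simp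
  moreover have "lam2 * ((R_mat *v u) \<bullet> ((snd V - snd U) *v (R_mat *v v)))
      \<le> lam2 * ((spectral_norm (R_mat :: real^('h,'w) ix3^('h,'w) ix2))\<^sup>2 * ?d * norm u * norm v)"
    using weight_entries_le(2)[of "V - U"] by (intro mult_left_mono block diag pos) simp
  ultimately show ?thesis
    by (simp add: weighted_form_def matrix_vector_mult_diff_rdistrib inner_diff_right algebra_simps)
qed

lemma T_map_diff_le:
  fixes f :: "real^('h::{finite,linorder},'w::{finite,linorder}) ix1"
  assumes V: "\<And>x. admissible_weights a b (\<W> x)" and pos: "0 < lam1" "0 < lam2" "0 < a"
  shows "(sigma_min (M_mat lam1 lam2 a :: real^('h,'w) ix3^('h,'w) ix5))\<^sup>2
      * norm (T_map lam1 lam2 f \<W> x - T_map lam1 lam2 f \<W> y)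
    \<le> (lam1 * (spectral_norm (G_mat :: real^('h,'w) ix3^('h,'w) ix2))\<^sup>2
        + lam2 * (spectral_norm (R_mat :: real^('h,'w) ix3^('h,'w) ix2))\<^sup>2)
      * weight_norm (\<W> x - \<W> y) * norm (T_map lam1 lam2 f \<W> x)"
    (is "?\<alpha> * norm (?u - ?v) \<le> ?C * weight_norm (\<W> x - \<W> y) * norm ?u")
proof -
  have "?\<alpha> * (norm (?v - ?u))\<^sup>2 \<le> weighted_form lam1 lam2 (\<W> y) (?v - ?u) (?v - ?u)"
    by (rule weighted_form_coercive[OF V pos])
  \<comment> \<open>Both equations have the same right-hand side, so the form with weights
    \<open>\<W> y\<close> at \<open>?v\<close> may be exchanged for the one with weights
    \<open>\<W> x\<close> at \<open>?u\<close>.\<close>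
  also have "\<dots> = weighted_form lam1 lam2 (\<W> x) ?u (?v - ?u)
      - weighted_form lam1 lam2 (\<W> y) ?u (?v - ?u)"
    by (simp add: bilinear_lsub[OF bilinear_weighted_form] T_map_equation[where \<W> = \<W>, OF V pos])
  also have "\<dots> \<le> ?C * weight_norm (\<W> x - \<W> y) * norm ?u * norm (?v - ?u)"
    using pos by (intro weighted_form_diff_le[OF V V]) auto
  finally have "norm (?u - ?v) * (?\<alpha> * norm (?u - ?v))
      \<le> norm (?u - ?v) * (?C * weight_norm (\<W> x - \<W> y) * norm ?u)"
    by (simp add: power2_eq_square norm_minus_commute ac_simps)
  moreover have "0 \<le> ?C * weight_norm (\<W> x - \<W> y) * norm ?u"
    using pos by (simp add: weight_norm_nonneg)
  ultimately show ?thesis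
    by (cases "?u = ?v") simp_all
qed

section \<open>Invariance of the ball, existence, uniqueness and linear convergence\<close>

theorem theorem6p4:
  fixes f :: "real^('h::{finite,linorder},'w::{finite,linorder}) ix1"
    and lam1 lam2 \<omega>\<^sub>m\<^sub>i\<^sub>n \<omega>\<^sub>m\<^sub>a\<^sub>x L \<kappa> \<alpha> r Q s g \<rho> :: real
    and \<W> :: "real^('h,'w) ix3 \<Rightarrow> ('h,'w) weights"
    and \<B> :: "(real^('h,'w) ix3) set"
    and T :: "real^('h,'w) ix3 \<Rightarrow> real^('h,'w) ix3"
  assumes dims: "CARD('h) \<ge> 2" "CARD('w) \<ge> 2"
    and params: "lam1 > 0" "lam2 > 0" "0 < \<omega>\<^sub>m\<^sub>i\<^sub>n" "\<omega>\<^sub>m\<^sub>i\<^sub>n \<le> \<omega>\<^sub>m\<^sub>a\<^sub>x" "\<omega>\<^sub>m\<^sub>a\<^sub>x < 1" "0 \<le> \<kappa>"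
    and weights: "\<And>x. admissible_weights \<omega>\<^sub>m\<^sub>i\<^sub>n \<omega>\<^sub>m\<^sub>a\<^sub>x (\<W> x)"
    and norms: "s = spectral_norm (S_mat :: real^('h,'w) ix3^('h,'w) ix1)"
      "g = spectral_norm (G_mat :: real^('h,'w) ix3^('h,'w) ix2)"
      "\<rho> = spectral_norm (R_mat :: real^('h,'w) ix3^('h,'w) ix2)"
    and alpha: "\<alpha> = (sigma_min (M_mat lam1 lam2 \<omega>\<^sub>m\<^sub>i\<^sub>n :: real^('h,'w) ix3^('h,'w) ix5))\<^sup>2"
    and radius: "r = s * norm f / \<alpha>"
    and ball: "\<B> = cball 0 r"
    and lipschitz: "\<And>x y. x \<in> \<B> \<Longrightarrow> y \<in> \<B> \<Longrightarrow> weight_norm (\<W> x - \<W> y) \<le> L * norm (x - y)"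
      "L \<le> \<kappa>"
    and map: "T = T_map lam1 lam2 f \<W>"
    and rate: "Q = (lam1 * g\<^sup>2 + lam2 * \<rho>\<^sup>2) * \<kappa> * s * norm f / \<alpha>\<^sup>2"
  shows "T ` \<B> \<subseteq> \<B>
    \<and> (\<exists>x\<in>\<B>. T x = x)
    \<and> (Q < 1 \<longrightarrow>
         contraction_on \<B> T
         \<and> (\<exists>x\<^sub>s\<in>\<B>. T x\<^sub>s = x\<^sub>s
              \<and> (\<forall>y\<in>\<B>. T y = y \<longrightarrow> y = x\<^sub>s)
              \<and> (\<forall>x :: nat \<Rightarrow> real^('h,'w) ix3.
                    x 0 \<in> \<B> \<and> (\<forall>k\<ge>1. x k = T (x (k - 1))) \<longrightarrow>
                    x \<longlonglongrightarrow> x\<^sub>s \<and> (\<forall>k. norm (x k - x\<^sub>s) \<le> Q ^ k * norm (x 0 - x\<^sub>s)))))"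
proof -
  have \<alpha>: "0 < \<alpha>"
    unfolding alpha using sigma_min_M_mat_pos[OF params(1-3), where 'h = 'h and 'w = 'w] by simp
  have s: "0 \<le> s"
    unfolding norms by (rule spectral_norm_nonneg)
  have r: "0 \<le> r"
    unfolding radius using s \<alpha> by simp
  have norm_T: "norm (T x) \<le> r" for x
    unfolding map radius norms alpha by (rule T_map_bound[OF weights params(1-3)])
  then have maps: "T ` \<B> \<subseteq> \<B>"
    by (auto simp: ball)
  define C where "C = lam1 * g\<^sup>2 + lam2 * \<rho>\<^sup>2"
  have C: "0 \<le> C"
    unfolding C_def using params by simp
  have Q: "0 \<le> Q"
    unfolding rate using params s by simp
  have T_diff: "norm (T x - T y) \<le> Q * norm (x - y)" if "x \<in> \<B>" "y \<in> \<B>" for x y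
  proof -
    have W: "weight_norm (\<W> x - \<W> y) \<le> \<kappa> * norm (x - y)"
      using lipschitz(1)[OF that] mult_right_mono[OF lipschitz(2), of "norm (x - y)"] by simp
    have "\<alpha> * norm (T x - T y) \<le> C * weight_norm (\<W> x - \<W> y) * norm (T x)"
      unfolding map C_def norms alpha by (rule T_map_diff_le[OF weights params(1-3)])
    also have "\<dots> \<le> C * (\<kappa> * norm (x - y)) * r"
      using W C params by (intro mult_mono norm_T) (auto simp: weight_norm_nonneg)
    \<comment> \<open>One factor 1/\<alpha> comes from \<open>r\<close> and one from coercivity,
      whence the square of \<alpha> in \<open>Q\<close>.\<close>
    also have "\<dots> = \<alpha> * (Q * norm (x - y))"
      using \<alpha> by (simp add: rate radius C_def power2_eq_square field_simps)
    finally show ?thesis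
      using \<alpha> by simp
  qed
  have lip: "Q-lipschitz_on \<B> T"
    using T_diff Q by (intro lipschitz_onI) (simp_all add: dist_norm)
  \<comment> \<open>Brouwer asks only for continuity, which the Lipschitz bound gives for every
    value of \<open>Q\<close>; \<open>0 \<le> r\<close> makes the ball nonempty.\<close>
  obtain x\<^sub>s where xs: "x\<^sub>s \<in> \<B>" "T x\<^sub>s = x\<^sub>s"
    using brouwer[of \<B> T] maps r lipschitz_on_continuous_on[OF lip]
    by (auto simp: ball image_subset_iff)
  have unique: "y = x\<^sub>s" if "Q < 1" "y \<in> \<B>" "T y = y" for y
  proof (rule ccontr)
    assume "y \<noteq> x\<^sub>s"
    moreover have "norm (y - x\<^sub>s) \<le> Q * norm (y - x\<^sub>s)"
      using T_diff[OF that(2) xs(1)] that xs by simp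
    ultimately show False
      using \<open>Q < 1\<close> by simp
  qed
  \<comment> \<open>Membership in the ball is carried through the induction because
    \<open>T_diff\<close> holds only there.\<close>
  have iter: "x k \<in> \<B> \<and> norm (x k - x\<^sub>s) \<le> Q ^ k * norm (x 0 - x\<^sub>s)"
    if "x 0 \<in> \<B>" "\<forall>k\<ge>1. x k = T (x (k - 1))" for x k
  proof (induction k)
    case (Suc k)
    have step: "x (Suc k) = T (x k)"
      using that(2) by simp
    have "norm (x (Suc k) - x\<^sub>s) \<le> Q * norm (x k - x\<^sub>s)"
      using T_diff[of "x k" x\<^sub>s] Suc xs step by simp
    also have "\<dots> \<le> Q * (Q ^ k * norm (x 0 - x\<^sub>s))"
      using Suc Q by (intro mult_left_mono) auto
    finally show ?case
      using Suc maps step by (auto simp: mult.assoc)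
  qed (use that in simp)
  have conv: "x \<longlonglongrightarrow> x\<^sub>s"
    if "Q < 1" "x 0 \<in> \<B>" "\<forall>k\<ge>1. x k = T (x (k - 1))" for x
  proof -
    have "(\<lambda>k. Q ^ k * norm (x 0 - x\<^sub>s)) \<longlonglongrightarrow> 0"
      using Q \<open>Q < 1\<close> by (intro tendsto_mult_left_zero LIMSEQ_realpow_zero)
    then have "(\<lambda>k. x k - x\<^sub>s) \<longlonglongrightarrow> 0"
      by (rule Lim_null_comparison[rotated]) (use iter[OF that(2,3)] in simp)
    then show ?thesis
      by (rule LIM_zero_cancel)
  qed
  have "contraction_on \<B> T" if "Q < 1"
    using that lip by (auto simp: contraction_on_def)
  with maps xs unique iter conv show ?thesis
    by blast
qed

end
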